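(* Let $(\langle G,m\rangle,p)$ be a periodic orbit framework on the $x$-variable torus $\mathcal T_x^2$ with $G$ connected, let $T$ be a spanning tree of $G$ with root $u$, and let $m_T$ be the resulting $T$-gain assignment. Define $p':V\to\mathbb R^2$ by $p'_i=p_i+m(v_i,T)L_x$, where $m(v_i,T)$ is the $T$-potential of $v_i$. Then $\operatorname{rank}\mathcal R_x(\langle G,m\rangle,p)=\operatorname{rank}\mathcal R_x(\langle G,m_T\rangle,p')$.
   Context: A periodic orbit graph $\langle G,m\rangle$ is a finite directed multigraph $G=(V,E)$ (loops, parallel edges allowed) with gains $m:E\to\mathbb Z^2$; $\{v_i,v_j;m_e\}$ denotes an edge from $v_i$ to $v_j$ with gain $m_e$, identified with $\{v_j,v_i;-m_e\}$. The net gain of a path is the sum of the gains of its edges, each with sign $+1$ or $-1$ according to whether it is traversed along or against its direction. Fix reals $y_1,y_2$ and let $L_x=\begin{pmatrix}x&0\\ y_1&y_2\end{pmatrix}$; for a row vector $z\in\mathbb Z^2$, $zL_x\in\mathbb R^2$. For $p:V\to\mathbb R^2$, $p_i=p(v_i)$, the rigidity matrix $\mathcal R_x(\langle G,m\rangle,p)$ is the $|E|\times(2|V|+1)$ matrix whose row for $e=\{v_i,v_j;m_e\}$ has $p_i-(p_j+m_eL_x)$ in the two columns of $v_i$, $(p_j+m_eL_x)-p_i$ in the two columns of $v_j$ (added if $i=j$), zeros in other vertex columns, and $(m_e)_x[p_i-(p_j+m_eL_x)]_x$ in the last column, $(\cdot)_x$ denoting the first coordinate. $T$-gain procedure: the $T$-potential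 $m(v,T)$ of a vertex $v$ is the net gain of the unique path in $T$ from the root $u$ to $v$; for an edge $e$ directed from $v$ to $w$, its $T$-gain is $m_T(e)=m(v,T)+m(e)-m(w,T)$. *)

theory Defs
  imports
    "HOL-Analysis.Cartesian_Space"
    "Graph_Theory.Digraph_Component"
    "Jordan_Normal_Form.DL_Rank"
begin

no_notation Matrix.vec_index (infixl "$" 100)

text \<open>
  Each arc of \<open>G\<close> may be traversed along its direction (flag \<open>True\<close>) or against it
  (flag \<open>False\<close>). Directed walks of the resulting digraph are the walks of the underlying
  undirected multigraph of \<open>G\<close>, together with the sign of each step.
\<close>
definition two_way :: "('a, 'b) pre_digraph \<Rightarrow> ('a, 'b \<times> bool) pre_digraph" where
  "two_way G = \<lparr> verts = verts G, arcs = arcs G \<times> UNIV,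
     tail = (\<lambda>(e, fwd). if fwd then tail G e else head G e),
     head = (\<lambda>(e, fwd). if fwd then head G e else tail G e) \<rparr>"

text \<open>
  The library's \<open>tree\<close> and \<open>spanning_tree\<close> only exclude directed cycles. Here, as usual for
  gain graphs, cycles are taken in the underlying undirected multigraph; requiring the arcs of a
  cycle to be distinct rules out going back and forth along one arc, while loops and pairs of
  parallel or antiparallel arcs do count as cycles.
\<close>
definition undirected_tree :: "('a, 'b) pre_digraph \<Rightarrow> bool" where
  "undirected_tree T \<longleftrightarrow> Digraph_Component.connected T \<and>
     \<not> (\<exists>c. pre_digraph.cycle (two_way T) c \<and> distinct (map fst c))"

definition undirected_spanning_tree :: "('a, 'b) pre_digraph \<Rightarrow> ('a, 'b) pre_digraph \<Rightarrow> bool" where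
  "undirected_spanning_tree T G \<longleftrightarrow> undirected_tree T \<and> spanning T G"

definition net_gain :: "('b \<Rightarrow> int ^ 2) \<Rightarrow> ('b \<times> bool) list \<Rightarrow> int ^ 2" where
  "net_gain m w = (\<Sum>(e, fwd) \<leftarrow> w. if fwd then m e else - m e)"

definition T_potential ::
    "('a, 'b) pre_digraph \<Rightarrow> 'a \<Rightarrow> ('b \<Rightarrow> int ^ 2) \<Rightarrow> 'a \<Rightarrow> int ^ 2" where
  "T_potential T u m v = net_gain m (THE w. pre_digraph.apath (two_way T) u w v)"

definition T_gain ::
    "('a, 'b) pre_digraph \<Rightarrow> ('a, 'b) pre_digraph \<Rightarrow> 'a \<Rightarrow> ('b \<Rightarrow> int ^ 2) \<Rightarrow> 'b \<Rightarrow> int ^ 2" where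
  "T_gain G T u m e = T_potential T u m (tail G e) + m e - T_potential T u m (head G e)"

definition torus_matrix :: "real \<Rightarrow> real \<Rightarrow> real \<Rightarrow> real ^ 2 ^ 2" where
  "torus_matrix x y\<^sub>1 y\<^sub>2 = vector [vector [x, 0], vector [y\<^sub>1, y\<^sub>2]]"

definition lattice_shift :: "int ^ 2 \<Rightarrow> real ^ 2 ^ 2 \<Rightarrow> real ^ 2" where
  "lattice_shift z L = (\<chi> i. real_of_int (z $ i)) v* L"

text \<open>
  The lists \<open>vs\<close> and \<open>es\<close> enumerate the vertices and the arcs of \<open>G\<close>. Columns
  \<open>2 * j\<close> and \<open>2 * j + 1\<close> belong to the vertex \<open>vs ! j\<close>, and the last column, \<open>2 * length vs\<close>,
  to the variable \<open>x\<close>. The row of an arc is unchanged when the arc is reversed and its gain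
  negated.
\<close>
definition rigidity_matrix ::
    "real ^ 2 ^ 2 \<Rightarrow> ('a, 'b) pre_digraph \<Rightarrow> 'a list \<Rightarrow> 'b list \<Rightarrow>
     ('b \<Rightarrow> int ^ 2) \<Rightarrow> ('a \<Rightarrow> real ^ 2) \<Rightarrow> real mat" where
  "rigidity_matrix L G vs es m p =
     Matrix.mat (length es) (2 * length vs + 1) (\<lambda>(r, c).
       let e = es ! r;
           p\<^sub>i = p (tail G e);
           q\<^sub>j = p (head G e) + lattice_shift (m e) L
       in if c = 2 * length vs then real_of_int (m e $ 1) * (p\<^sub>i - q\<^sub>j) $ 1
          else let v = vs ! (c div 2);
                   k = (if even c then 1 else 2)
               in (if v = tail G e then (p\<^sub>i - q\<^sub>j) $ k else 0) +
                  (if v = head G e then (q\<^sub>j - p\<^sub>i) $ k else 0))"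

end

theory Submission
  imports Defs
begin

text \<open>
  The vector \<open>p\<^sub>i - (p\<^sub>j + m\<^sub>e L)\<close> of an arc is unchanged when the gains are switched by a potential
  \<open>\<phi>\<close> on the vertices and the positions are moved along by \<open>\<phi> L\<close>. Hence only the last column of the
  rigidity matrix changes, namely by the sum, over all vertices \<open>v\<close>, of \<open>(\<phi> v)\<^sub>x\<close> times the first
  column of \<open>v\<close>. This column operation preserves the rank. The theorem is the case where
  \<open>\<phi>\<close> is the \<open>T\<close>-potential.
\<close>

context vec_space
begin

text \<open>Every combination of the columns of \<open>B\<close> can be rewritten in the columns of
  \<open>A\<close> by expanding the last one. Proving only one inclusion lets the converse follow by
  running the same operation backwards.\<close>

lemma col_space_subset_add_to_last_col:
  assumes A: "A \<in> carrier_mat n (Suc k)" and B: "B \<in> carrier_mat n (Suc k)"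
    and init: "\<And>i j. i < n \<Longrightarrow> j < k \<Longrightarrow> B $$ (i, j) = A $$ (i, j)"
    and last: "\<And>i. i < n \<Longrightarrow> B $$ (i, k) = A $$ (i, k) + (\<Sum>j<k. c j * A $$ (i, j))"
  shows "col_space B \<subseteq> col_space A"
proof
  fix y assume "y \<in> col_space B"
  then obtain z where z: "z \<in> carrier_vec (Suc k)" and y: "y = B *\<^sub>v z"
    using col_space_eq[OF B] B by auto
  \<comment> \<open>\<open>w\<close> is the image of \<open>z\<close> under the unitriangular matrix
    that performs the column operation: the weight \<open>z\<close> puts on the last column is also
    passed to each column \<open>j\<close>, scaled by \<open>c j\<close>.\<close>
  define w where "w = Matrix.vec (Suc k)
    (\<lambda>j. if j < k then vec_index z j + c j * vec_index z k else vec_index z k)"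
  have "A *\<^sub>v w = B *\<^sub>v z"
  proof (rule eq_vecI)
    fix i assume "i < dim_vec (B *\<^sub>v z)"
    then have i: "i < n" using B by simp
    have "vec_index (A *\<^sub>v w) i = (\<Sum>j<Suc k. A $$ (i, j) * vec_index w j)"
      using A i by (simp add: scalar_prod_def w_def lessThan_atLeast0)
    also have "\<dots> = (\<Sum>j<k. A $$ (i, j) * (vec_index z j + c j * vec_index z k))
        + A $$ (i, k) * vec_index z k"
      by (simp add: w_def)
    also have "\<dots> = (\<Sum>j<k. A $$ (i, j) * vec_index z j)
        + (A $$ (i, k) + (\<Sum>j<k. c j * A $$ (i, j))) * vec_index z k"
      by (simp add: algebra_simps sum.distrib sum_distrib_left)
    also have "\<dots> = (\<Sum>j<Suc k. B $$ (i, j) * vec_index z j)"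
      using i by (simp add: init last)
    also have "\<dots> = vec_index (B *\<^sub>v z) i"
      using B z i by (simp add: scalar_prod_def lessThan_atLeast0)
    finally show "vec_index (A *\<^sub>v w) i = vec_index (B *\<^sub>v z) i" .
  qed (use A B in simp)
  moreover have "w \<in> carrier_vec (Suc k)" by (simp add: w_def)
  ultimately show "y \<in> col_space A"
    using A B y by (auto simp: col_space_eq[OF A] intro: carrier_vecI)
qed

lemma rank_add_to_last_col:
  assumes A: "A \<in> carrier_mat n (Suc k)" and B: "B \<in> carrier_mat n (Suc k)"
    and init: "\<And>i j. i < n \<Longrightarrow> j < k \<Longrightarrow> B $$ (i, j) = A $$ (i, j)"
    and last: "\<And>i. i < n \<Longrightarrow> B $$ (i, k) = A $$ (i, k) + (\<Sum>j<k. c j * A $$ (i, j))"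
  shows "rank A = rank B"
proof -
  have "col_space B \<subseteq> col_space A"
    by (rule col_space_subset_add_to_last_col[OF A B init last])
  \<comment> \<open>The first \<open>k\<close> columns agree, so subtracting the same combination
    undoes the operation.\<close>
  moreover have "col_space A \<subseteq> col_space B"
    by (rule col_space_subset_add_to_last_col[OF B A, where c = "\<lambda>j. - c j"])
      (simp_all add: init last sum_negf)
  ultimately show ?thesis
    unfolding rank_def col_space_def by (simp add: subset_antisym)
qed

end

lemma sum_lessThan_double:
  fixes f :: "nat \<Rightarrow> 'a::comm_monoid_add"
  shows "(\<Sum>j<2 * N. f j) = (\<Sum>t<N. f (2 * t) + f (2 * t + 1))"
  by (induction N) (simp_all add: add.assoc)

lemma lattice_shift_add: "lattice_shift (a + b) L = lattice_shift a L + lattice_shift b L"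
  by (simp add: lattice_shift_def Finite_Cartesian_Product.vec_eq_iff vector_matrix_mult_def algebra_simps sum.distrib)

lemma lattice_shift_diff: "lattice_shift (a - b) L = lattice_shift a L - lattice_shift b L"
  by (simp add: lattice_shift_def Finite_Cartesian_Product.vec_eq_iff vector_matrix_mult_def algebra_simps sum_subtractf)

lemma rank_rigidity_matrix_switch:
  fixes G :: "('a, 'b) pre_digraph" and \<phi> :: "'a \<Rightarrow> int ^ 2"
  assumes "wf_digraph G" and vs: "distinct vs" "set vs = verts G" and es: "set es = arcs G"
    and p': "\<And>v. v \<in> verts G \<Longrightarrow> p' v = p v + lattice_shift (\<phi> v) L"
    and m': "\<And>e. e \<in> arcs G \<Longrightarrow> m' e = \<phi> (tail G e) + m e - \<phi> (head G e)"
  shows "vec_space.rank (length es) (rigidity_matrix L G vs es m p) =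
         vec_space.rank (length es) (rigidity_matrix L G vs es m' p')"
proof -
  interpret wf_digraph G by fact
  define d where "d e = p (tail G e) - (p (head G e) + lattice_shift (m e) L)" for e
  let ?N = "length vs"
  let ?A = "rigidity_matrix L G vs es m p" and ?B = "rigidity_matrix L G vs es m' p'"
  \<comment> \<open>Even columns hold first coordinates, the only ones entering the last column;
    hence weight 0 on odd columns.\<close>
  define c where "c j = (if even j then real_of_int (\<phi> (vs ! (j div 2)) $ 1) else 0)" for j
  \<comment> \<open>The shifts of the two endpoints cancel against the two potentials contained in
    \<open>m' e\<close>.\<close>
  have d': "p' (tail G e) - (p' (head G e) + lattice_shift (m' e) L) = d e"
    if "e \<in> arcs G" for e
    using that by (simp add: d_def p' m' lattice_shift_add lattice_shift_diff)
  \<comment> \<open>With both summands expressed through the one difference vector \<open>f\<close>,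
    vertex entries depend on positions and gains only via \<open>f\<close>, so \<open>d'\<close>
    transfers them.\<close>
  have vert: "rigidity_matrix L G vs es \<mu> q $$ (r, j) =
      (let e = es ! r; k = (if even j then 1 else 2);
           f = q (tail G e) - (q (head G e) + lattice_shift (\<mu> e) L)
       in (if vs ! (j div 2) = tail G e then f $ k else 0) -
          (if vs ! (j div 2) = head G e then f $ k else 0))"
    if "r < length es" "j < 2 * ?N" for \<mu> q r j
    using that by (simp add: rigidity_matrix_def Let_def)
  have B_vert: "?B $$ (r, j) = ?A $$ (r, j)" if r: "r < length es" and j: "j < 2 * ?N" for r j
  proof -
    have "es ! r \<in> arcs G" using r es nth_mem by blast
    from d'[OF this] show ?thesis
      unfolding vert[OF r j] by (simp only: Let_def d_def)
  qed
  have B_last: "?B $$ (r, 2 * ?N) = ?A $$ (r, 2 * ?N) + (\<Sum>j<2 * ?N. c j * ?A $$ (r, j))"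
    if r: "r < length es" for r
  proof -
    define e where "e = es ! r"
    have e: "e \<in> arcs G" using r es by (auto simp: e_def)
    \<comment> \<open>\<open>g v\<close> is what the two columns of \<open>v\<close> contribute to
      the weighted sum in row \<open>r\<close>.\<close>
    define g where "g v = real_of_int (\<phi> v $ 1) *
      ((if v = tail G e then d e $ 1 else 0) - (if v = head G e then d e $ 1 else 0))" for v
    have "(\<Sum>j<2 * ?N. c j * ?A $$ (r, j)) = (\<Sum>t<?N. g (vs ! t))"
      unfolding sum_lessThan_double
      by (rule sum.cong) (use r in \<open>simp_all add: vert c_def g_def e_def d_def Let_def\<close>)
    also have "\<dots> = (\<Sum>v\<in>verts G. g v)"
      using sum.distinct_set_conv_list[OF vs(1), of g] vs(2)
      by (simp add: sum_list_sum_nth lessThan_atLeast0)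
    also have "\<dots> = (\<Sum>v\<in>verts G. if v = tail G e then real_of_int (\<phi> v $ 1) * d e $ 1 else 0)
        - (\<Sum>v\<in>verts G. if v = head G e then real_of_int (\<phi> v $ 1) * d e $ 1 else 0)"
      unfolding sum_subtractf[symmetric] by (rule sum.cong) (simp_all add: g_def algebra_simps)
    \<comment> \<open>Only the endpoints of \<open>e\<close> survive. The factor is the first
      coordinate of \<open>m' e - m e\<close>, exactly the change needed in the last column; for a
      loop both are 0.\<close>
    also have "\<dots> = (real_of_int (\<phi> (tail G e) $ 1) - real_of_int (\<phi> (head G e) $ 1)) * d e $ 1"
      using e vs(2)[symmetric] tail_in_verts[OF e] head_in_verts[OF e] by (simp add: left_diff_distrib)
    finally have sum: "(\<Sum>j<2 * ?N. c j * ?A $$ (r, j)) = \<dots>" .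
    have "?A $$ (r, 2 * ?N) = real_of_int (m e $ 1) * d e $ 1"
      using r by (simp add: rigidity_matrix_def d_def e_def Let_def)
    moreover have "?B $$ (r, 2 * ?N) = real_of_int (m' e $ 1) * d e $ 1"
      using r d'[OF e] by (simp add: rigidity_matrix_def e_def Let_def)
    ultimately show ?thesis
      unfolding sum by (simp add: m'[OF e] algebra_simps)
  qed
  show ?thesis
    by (rule vec_space.rank_add_to_last_col[where k = "2 * ?N" and c = c])
      (simp_all add: B_vert B_last, simp_all add: rigidity_matrix_def)
qed

theorem theorem2p2:
  fixes G T :: "('a, 'b) pre_digraph"
    and vs :: "'a list" and es :: "'b list"
    and m :: "'b \<Rightarrow> int ^ 2"
    and p p' :: "'a \<Rightarrow> real ^ 2"
    and x y\<^sub>1 y\<^sub>2 :: real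
    and u :: 'a
  assumes "fin_digraph G"
    and "distinct vs" and "set vs = verts G"
    and "distinct es" and "set es = arcs G"
    and "Digraph_Component.connected G"
    and "undirected_spanning_tree T G"
    and "u \<in> verts T"
    and "\<And>v. v \<in> verts G \<Longrightarrow>
           p' v = p v + lattice_shift (T_potential T u m v) (torus_matrix x y\<^sub>1 y\<^sub>2)"
  shows "vec_space.rank (length es) (rigidity_matrix (torus_matrix x y\<^sub>1 y\<^sub>2) G vs es m p) =
         vec_space.rank (length es)
           (rigidity_matrix (torus_matrix x y\<^sub>1 y\<^sub>2) G vs es (T_gain G T u m) p')"
  by (rule rank_rigidity_matrix_switch[where \<phi> = "T_potential T u m"])
    (use assms in \<open>simp_all add: fin_digraph_def T_gain_def\<close>)

end
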